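(* Let $K$ be a field and let $I\subset K[x_1,x_2]$ be a monomial ideal whose set of minimal monomial generators is $$G(I)=\{x_1^{a_1}x_2^{b_1},\;x_1^{a_2}x_2^{b_2},\ldots,x_1^{a_m}x_2^{b_m}\},$$ where $a_1>a_2>\cdots>a_m\geq 0$ and $0\leq b_1<b_2<\cdots<b_m$. Then $$\operatorname{slength}(I)=\min\{a_i+b_i-a_m-b_1\;:\;1\leq i\leq m\}+1.$$
   Context: Let $S=K[x_1,\ldots,x_n]$ (here $n=2$) and let $M$ be a finitely generated $\mathbb Z^n$-graded $S$-module. A Stanley decomposition of $M$ is a finite direct sum of $K$-vector spaces $\mathcal D: M=\bigoplus_{i=1}^r m_iK[Z_i]$, where each $m_i\in M$ is homogeneous, $Z_i\subset\{x_1,\ldots,x_n\}$, and $m_iK[Z_i]$ is a free $K[Z_i]$-module. Its length is $\operatorname{slength}(\mathcal D)=r$, and the Stanley length of $M$ is $\operatorname{slength}(M)=\min\{\operatorname{slength}(\mathcal D):\mathcal D\text{ is a Stanley decomposition of }M\}$. *)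

theory Defs
  imports Complex_Main "HOL-Library.Poly_Mapping" "HOL-Library.Numeral_Type"
begin

text \<open>
  The polynomial ring over \<open>'k\<close> in variables indexed by \<open>'x\<close>, as the monoid algebra of the
  exponent vectors. For two variables the index type is \<open>2\<close>, whose two elements
  are \<open>1\<close> and \<open>2 = 0\<close>.
\<close>

type_synonym ('x, 'k) mpoly = "('x \<Rightarrow>\<^sub>0 nat) \<Rightarrow>\<^sub>0 'k"

definition Var :: "'x \<Rightarrow> ('x, 'k::field) mpoly" where
  "Var x = Poly_Mapping.single (Poly_Mapping.single x 1) 1"

definition monomials :: "('x, 'k::field) mpoly set" where
  "monomials = range (\<lambda>t. Poly_Mapping.single t 1)"

definition polys_in :: "'x set \<Rightarrow> ('x, 'k::field) mpoly set" where
  "polys_in Z = {f. \<forall>t \<in> Poly_Mapping.keys f. Poly_Mapping.keys t \<subseteq> Z}"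

text \<open>The ideal generated by \<open>B\<close> is the submodule \<open>module.span (*) B\<close> of the ring.\<close>

definition monomial_ideal :: "('x, 'k::field) mpoly set \<Rightarrow> bool" where
  "monomial_ideal I \<longleftrightarrow> (\<exists>B \<subseteq> monomials. I = module.span (*) B)"

definition minimal_monomial_generators ::
    "('x, 'k::field) mpoly set \<Rightarrow> ('x, 'k) mpoly set \<Rightarrow> bool" where
  "minimal_monomial_generators I G \<longleftrightarrow>
     G \<subseteq> monomials \<and> module.span (*) G = I \<and> (\<forall>G'. G' \<subset> G \<longrightarrow> module.span (*) G' \<noteq> I)"

text \<open>
  The module \<open>N\<close> over the subring \<open>R\<close> has a basis \<open>B\<close>: every element is a unique finite
  \<open>R\<close>-linear combination of elements of \<open>B\<close>.
\<close>

definition free_module_over ::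
    "'r set \<Rightarrow> ('r::comm_ring_1 \<Rightarrow> 'm::ab_group_add \<Rightarrow> 'm) \<Rightarrow> 'm set \<Rightarrow> bool" where
  "free_module_over R scale N \<longleftrightarrow>
     (\<exists>B \<subseteq> N. \<forall>v \<in> N. \<exists>!c :: 'm \<Rightarrow>\<^sub>0 'r.
        Poly_Mapping.keys c \<subseteq> B \<and> range (Poly_Mapping.lookup c) \<subseteq> R \<and>
        v = (\<Sum>b \<in> Poly_Mapping.keys c. scale (Poly_Mapping.lookup c b) b))"

definition internal_direct_sum :: "'m::ab_group_add set \<Rightarrow> nat \<Rightarrow> (nat \<Rightarrow> 'm set) \<Rightarrow> bool" where
  "internal_direct_sum M r V \<longleftrightarrow>
     M = {\<Sum>i<r. y i | y. \<forall>i<r. y i \<in> V i} \<and>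
     (\<forall>y. (\<forall>i<r. y i \<in> V i) \<and> (\<Sum>i<r. y i) = 0 \<longrightarrow> (\<forall>i<r. y i = 0))"

definition stanley_space ::
    "(('x, 'k::field) mpoly \<Rightarrow> 'm::ab_group_add \<Rightarrow> 'm) \<Rightarrow> 'm \<Rightarrow> 'x set \<Rightarrow> 'm set" where
  "stanley_space scale u Z = (\<lambda>f. scale f u) ` polys_in Z"

text \<open>
  A multigraded module is given by its scalar multiplication \<open>scale\<close>, its carrier \<open>M\<close> and its
  family \<open>deg\<close> of homogeneous components, indexed by integer vectors.
  A Stanley decomposition is the list of the pairs \<open>(m_i, Z_i)\<close>.
\<close>

definition stanley_decomposition ::
    "(('x, 'k::field) mpoly \<Rightarrow> 'm::ab_group_add \<Rightarrow> 'm) \<Rightarrow> (('x \<Rightarrow> int) \<Rightarrow> 'm set) \<Rightarrow> 'm set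
      \<Rightarrow> ('m \<times> 'x set) list \<Rightarrow> bool" where
  "stanley_decomposition scale deg M D \<longleftrightarrow>
     (\<forall>(u, Z) \<in> set D. u \<in> M \<and> (\<exists>d. u \<in> deg d) \<and>
        free_module_over (polys_in Z) scale (stanley_space scale u Z)) \<and>
     internal_direct_sum M (length D) (\<lambda>i. stanley_space scale (fst (D ! i)) (snd (D ! i)))"

definition stanley_length ::
    "(('x, 'k::field) mpoly \<Rightarrow> 'm::ab_group_add \<Rightarrow> 'm) \<Rightarrow> (('x \<Rightarrow> int) \<Rightarrow> 'm set) \<Rightarrow> 'm set
      \<Rightarrow> nat" where
  "stanley_length scale deg M =
     (LEAST r. \<exists>D. stanley_decomposition scale deg M D \<and> length D = r)"

text \<open>The homogeneous components of the polynomial ring in its fine grading.\<close>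

definition fine_component :: "('x \<Rightarrow> int) \<Rightarrow> ('x, 'k::field) mpoly set" where
  "fine_component d =
     {f. \<forall>t \<in> Poly_Mapping.keys f. \<forall>x. int (Poly_Mapping.lookup t x) = d x}"

definition slength :: "('x, 'k::field) mpoly set \<Rightarrow> nat" where
  "slength I = stanley_length (*) (\<lambda>d. I \<inter> fine_component d) I"

end

theory Submission
  imports Defs "HOL-Library.Disjoint_Sets"
begin

text \<open>
  Homogeneous elements of the polynomial ring are scalar multiples of monomials, so Stanley
  decompositions of a monomial ideal amount to partitions of its set \<open>E\<close> of exponents into cones
  \<open>s + \<nat>\<^sup>Z\<close>. In the plane, a column \<open>c \<ge> a\<^sub>m\<close> contains infinitely many points of \<open>E\<close>, so it is met by
  a quadrant or contains a vertical cone, and likewise for rows. Hence there is a quadrant; it is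
  unique since two quadrants meet; and if its apex is \<open>(p, q)\<close>, which dominates some
  \<open>(a\<^sub>i, b\<^sub>i)\<close>, at least \<open>p - a\<^sub>m\<close> vertical and \<open>q - b\<^sub>1\<close> horizontal cones are needed.
  Conversely, the quadrant at \<open>(a\<^sub>i, b\<^sub>i)\<close> together with all columns of \<open>E\<close> to the left of it and all
  rows below it partitions \<open>E\<close>, since no point of \<open>E\<close> lies both to the left and below.
\<close>

section \<open>Coefficients: multiplication by a monomial and restriction of the support\<close>

lemma poly_mapping_eq_sum_single:
  "(\<Sum>t\<in>Poly_Mapping.keys f. Poly_Mapping.single t (Poly_Mapping.lookup f t)) = f"
  by (rule poly_mapping_eqI)
    (simp add: lookup_sum lookup_single when_def sum.delta' in_keys_iff)

lemma lookup_times_single: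
  fixes f :: "'a::cancel_comm_monoid_add \<Rightarrow>\<^sub>0 'b::comm_semiring_1"
  shows "Poly_Mapping.lookup (f * Poly_Mapping.single s c) (s + t) = Poly_Mapping.lookup f t * c"
proof -
  have "f * Poly_Mapping.single s c =
      (\<Sum>t\<in>Poly_Mapping.keys f. Poly_Mapping.single (s + t) (Poly_Mapping.lookup f t * c))"
    by (subst poly_mapping_eq_sum_single[of f, symmetric])
      (simp add: sum_distrib_right mult_single add.commute)
  then show ?thesis
    by (simp add: lookup_sum lookup_single when_def in_keys_iff)
qed

text \<open>When the sets \<open>A\<close> run through a partition of the exponents, these are the
  components of \<open>f\<close> in the corresponding direct sum.\<close>

definition restrict_keys :: "'a set \<Rightarrow> ('a \<Rightarrow>\<^sub>0 'b::comm_monoid_add) \<Rightarrow> 'a \<Rightarrow>\<^sub>0 'b" where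
  "restrict_keys A f =
     (\<Sum>t\<in>Poly_Mapping.keys f \<inter> A. Poly_Mapping.single t (Poly_Mapping.lookup f t))"

lemma lookup_restrict_keys:
  "Poly_Mapping.lookup (restrict_keys A f) t = (if t \<in> A then Poly_Mapping.lookup f t else 0)"
  by (auto simp: restrict_keys_def lookup_sum lookup_single when_def in_keys_iff)

lemma keys_restrict_keys: "Poly_Mapping.keys (restrict_keys A f) = Poly_Mapping.keys f \<inter> A"
  by (auto simp: in_keys_iff lookup_restrict_keys split: if_splits)

section \<open>Cones of exponents and the Stanley spaces of monomials\<close>

fun cone :: "('x \<Rightarrow>\<^sub>0 nat) \<times> 'x set \<Rightarrow> ('x \<Rightarrow>\<^sub>0 nat) set" where
  "cone (s, Z) = {s + t | t. Poly_Mapping.keys t \<subseteq> Z}"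

lemma mem_cone_iff:
  "t \<in> cone (s, Z) \<longleftrightarrow>
     (\<forall>x. Poly_Mapping.lookup s x \<le> Poly_Mapping.lookup t x \<and>
       (x \<notin> Z \<longrightarrow> Poly_Mapping.lookup t x = Poly_Mapping.lookup s x))"
  (is "?L \<longleftrightarrow> ?R")
proof
  assume ?L
  then show ?R
    by (auto simp: lookup_add in_keys_iff)
next
  assume R: ?R
  \<comment> \<open>Subtraction of exponents is truncated in each coordinate; it is exact here
    because \<open>s\<close> lies below \<open>t\<close>.\<close>
  then have "t = s + (t - s)"
    by (intro poly_mapping_eqI) (simp add: lookup_add lookup_minus)
  moreover have "Poly_Mapping.keys (t - s) \<subseteq> Z"
    using R by (auto simp: in_keys_iff lookup_minus)
  ultimately show ?L
    by auto
qed

declare cone.simps [simp del]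

lemma apex_in_cone: "s \<in> cone (s, Z)"
  by (simp add: mem_cone_iff)

text \<open>A nonzero scalar \<open>c\<close> is a unit, so only the exponent \<open>s\<close> and
  the directions \<open>Z\<close> matter. This replaces Stanley spaces by sets of exponents.\<close>

lemma stanley_space_monomial:
  fixes c :: "'k::field"
  assumes "c \<noteq> 0"
  shows "stanley_space (*) (Poly_Mapping.single s c) Z = {f. Poly_Mapping.keys f \<subseteq> cone (s, Z)}"
proof (intro equalityI subsetI)
  fix f :: "('a, 'k) mpoly"
  assume "f \<in> stanley_space (*) (Poly_Mapping.single s c) Z"
  then obtain g where g: "\<forall>t\<in>Poly_Mapping.keys g. Poly_Mapping.keys t \<subseteq> Z"
      and f: "f = g * Poly_Mapping.single s c"
    by (auto simp: stanley_space_def polys_in_def)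
  have "Poly_Mapping.keys f \<subseteq>
      {t + s' | t s'. t \<in> Poly_Mapping.keys g \<and> s' \<in> Poly_Mapping.keys (Poly_Mapping.single s c)}"
    unfolding f by (rule keys_mult)
  also have "\<dots> \<subseteq> cone (s, Z)"
    using g assms by (auto simp: cone.simps add.commute[of _ s])
  finally show "f \<in> {f. Poly_Mapping.keys f \<subseteq> cone (s, Z)}"
    by simp
next
  fix f :: "('a, 'k) mpoly"
  assume "f \<in> {f. Poly_Mapping.keys f \<subseteq> cone (s, Z)}"
  then have f: "\<exists>t'. t = s + t' \<and> Poly_Mapping.keys t' \<subseteq> Z" if "t \<in> Poly_Mapping.keys f" for t
    using that by (auto simp: cone.simps)
  \<comment> \<open>\<open>g\<close> is the quotient of \<open>f\<close> by the monomial, formed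
    term by term. The differences \<open>t - s\<close> are exact because the exponents of
    \<open>f\<close> lie in the cone.\<close>
  define g where
    "g = (\<Sum>t\<in>Poly_Mapping.keys f. Poly_Mapping.single (t - s) (Poly_Mapping.lookup f t / c))"
  have "g * Poly_Mapping.single s c =
      (\<Sum>t\<in>Poly_Mapping.keys f. Poly_Mapping.single t (Poly_Mapping.lookup f t))"
    unfolding g_def sum_distrib_right
  proof (rule sum.cong[OF refl])
    fix t assume "t \<in> Poly_Mapping.keys f"
    then obtain t' where "t = s + t'"
      using f by auto
    then show "Poly_Mapping.single (t - s) (Poly_Mapping.lookup f t / c) * Poly_Mapping.single s c
        = Poly_Mapping.single t (Poly_Mapping.lookup f t)"
      using assms by (simp add: mult_single add.commute)
  qed
  then have "g * Poly_Mapping.single s c = f"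
    by (simp add: poly_mapping_eq_sum_single)
  moreover have "g \<in> polys_in Z"
  proof -
    have "Poly_Mapping.keys g \<subseteq> (\<lambda>t. t - s) ` Poly_Mapping.keys f"
      unfolding g_def by (rule order_trans[OF keys_sum]) (auto split: if_splits)
    moreover have "Poly_Mapping.keys (t - s) \<subseteq> Z" if "t \<in> Poly_Mapping.keys f" for t
      using f[OF that] by auto
    ultimately show ?thesis
      unfolding polys_in_def by auto
  qed
  ultimately show "f \<in> stanley_space (*) (Poly_Mapping.single s c) Z"
    by (auto simp: stanley_space_def)
qed

text \<open>The basis is \<open>u\<close> alone; cancellation of \<open>u\<close> makes the
  coefficient unique.\<close>

lemma free_module_over_cyclic:
  fixes u :: "'r::comm_ring_1"
  assumes R: "0 \<in> R" "1 \<in> R" and cancel: "\<And>f g. f * u = g * u \<Longrightarrow> f = g"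
  shows "free_module_over R (*) ((\<lambda>f. f * u) ` R)"
  unfolding free_module_over_def
proof (intro exI[of _ "{u}"] conjI ballI)
  show "{u} \<subseteq> (\<lambda>f. f * u) ` R"
    using R(2) by (auto intro!: image_eqI[where x = 1])
  fix v assume "v \<in> (\<lambda>f. f * u) ` R"
  then obtain f where f: "f \<in> R" "v = f * u"
    by auto
  \<comment> \<open>A zero coefficient at \<open>u\<close> leaves the support of \<open>c\<close>
    empty, so the sum is extended to \<open>{u}\<close> by a vanishing term.\<close>
  have sum_keys: "(\<Sum>b\<in>Poly_Mapping.keys c. Poly_Mapping.lookup c b * b) = Poly_Mapping.lookup c u * u"
    if "Poly_Mapping.keys c \<subseteq> {u}" for c :: "'r \<Rightarrow>\<^sub>0 'r"
    by (subst sum.mono_neutral_left[where T = "{u}"]) (use that in \<open>auto simp: in_keys_iff\<close>)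
  show "\<exists>!c. Poly_Mapping.keys c \<subseteq> {u} \<and> range (Poly_Mapping.lookup c) \<subseteq> R \<and>
      v = (\<Sum>b\<in>Poly_Mapping.keys c. Poly_Mapping.lookup c b * b)"
  proof (rule ex1I[of _ "Poly_Mapping.single u f"])
    show "Poly_Mapping.keys (Poly_Mapping.single u f) \<subseteq> {u} \<and>
        range (Poly_Mapping.lookup (Poly_Mapping.single u f)) \<subseteq> R \<and>
        v = (\<Sum>b\<in>Poly_Mapping.keys (Poly_Mapping.single u f).
              Poly_Mapping.lookup (Poly_Mapping.single u f) b * b)"
      using f R by (subst sum_keys) (auto simp: lookup_single when_def)
  next
    fix c
    assume c: "Poly_Mapping.keys c \<subseteq> {u} \<and> range (Poly_Mapping.lookup c) \<subseteq> R \<and>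
      v = (\<Sum>b\<in>Poly_Mapping.keys c. Poly_Mapping.lookup c b * b)"
    then have "Poly_Mapping.lookup c u = f"
      using f sum_keys cancel by auto
    then show "c = Poly_Mapping.single u f"
      using c by (intro poly_mapping_eqI) (auto simp: lookup_single when_def in_keys_iff)
  qed
qed

lemma free_stanley_space_monomial:
  fixes c :: "'k::field"
  assumes "c \<noteq> 0"
  shows "free_module_over (polys_in Z) (*) (stanley_space (*) (Poly_Mapping.single s c) Z)"
  unfolding stanley_space_def
proof (rule free_module_over_cyclic)
  fix f g :: "('a, 'k) mpoly"
  assume "f * Poly_Mapping.single s c = g * Poly_Mapping.single s c"
  \<comment> \<open>Multiplication by a monomial only shifts and scales the coefficients, so it is
    injective.\<close>
  then have "Poly_Mapping.lookup f t * c = Poly_Mapping.lookup g t * c" for t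
    by (metis lookup_times_single)
  then show "f = g"
    using assms by (intro poly_mapping_eqI) auto
qed (auto simp: polys_in_def)

section \<open>From cone partitions to Stanley decompositions\<close>

definition cone_partition ::
    "('x \<Rightarrow>\<^sub>0 nat) set \<Rightarrow> (('x \<Rightarrow>\<^sub>0 nat) \<times> 'x set) set \<Rightarrow> bool" where
  "cone_partition E P \<longleftrightarrow> finite P \<and> disjoint_family_on cone P \<and> \<Union> (cone ` P) = E"

text \<open>Restricting \<open>f\<close> to each block yields its components. The sum is direct
  because only the summand whose block contains \<open>t\<close> can have a nonzero coefficient at
  \<open>t\<close>.\<close>

lemma internal_direct_sum_restrict:
  fixes E :: "'a set" and T :: "nat \<Rightarrow> 'a set"
  assumes disj: "disjoint_family_on T {..<r}" and E: "\<Union> (T ` {..<r}) = E"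
  shows "internal_direct_sum {f :: 'a \<Rightarrow>\<^sub>0 'b::ab_group_add. Poly_Mapping.keys f \<subseteq> E} r
           (\<lambda>i. {f. Poly_Mapping.keys f \<subseteq> T i})"
  unfolding internal_direct_sum_def
proof (intro conjI equalityI subsetI allI impI)
  fix f :: "'a \<Rightarrow>\<^sub>0 'b" assume "f \<in> {f. Poly_Mapping.keys f \<subseteq> E}"
  then have f: "Poly_Mapping.keys f \<subseteq> E"
    by simp
  have "(\<Sum>i<r. restrict_keys (T i) f) = f"
  proof (rule poly_mapping_eqI)
    fix t
    show "Poly_Mapping.lookup (\<Sum>i<r. restrict_keys (T i) f) t = Poly_Mapping.lookup f t"
    proof (cases "t \<in> E")
      case True
      then obtain j where j: "j < r" "t \<in> T j"
        using E by auto
      have "t \<in> T i \<longleftrightarrow> i = j" if "i < r" for i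
        using disj j that by (auto simp: disjoint_family_on_def)
      then have "(\<Sum>i<r. if t \<in> T i then Poly_Mapping.lookup f t else 0)
          = (\<Sum>i<r. if i = j then Poly_Mapping.lookup f t else 0)"
        by (intro sum.cong) auto
      then show ?thesis
        using j by (simp add: lookup_sum lookup_restrict_keys)
    next
      case False
      then have "t \<notin> T i" if "i < r" for i
        using E that by auto
      then have "(\<Sum>i<r. if t \<in> T i then Poly_Mapping.lookup f t else 0) = 0"
        by (intro sum.neutral) auto
      moreover have "Poly_Mapping.lookup f t = 0"
        using False f by (auto simp: in_keys_iff)
      ultimately show ?thesis
        by (simp add: lookup_sum lookup_restrict_keys)
    qed
  qed
  then show "f \<in> {\<Sum>i<r. y i |y. \<forall>i<r. y i \<in> {f. Poly_Mapping.keys f \<subseteq> T i}}"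
    by (intro CollectI exI[of _ "\<lambda>i. restrict_keys (T i) f"]) (auto simp: keys_restrict_keys)
next
  fix f :: "'a \<Rightarrow>\<^sub>0 'b"
  assume "f \<in> {\<Sum>i<r. y i |y. \<forall>i<r. y i \<in> {f. Poly_Mapping.keys f \<subseteq> T i}}"
  then obtain y where y: "f = (\<Sum>i<r. y i)" "\<forall>i<r. Poly_Mapping.keys (y i) \<subseteq> T i"
    by auto
  have "Poly_Mapping.keys f \<subseteq> (\<Union>i<r. Poly_Mapping.keys (y i))"
    unfolding y(1) by (rule keys_sum)
  then show "f \<in> {f. Poly_Mapping.keys f \<subseteq> E}"
    using y(2) E by blast
next
  fix y :: "nat \<Rightarrow> 'a \<Rightarrow>\<^sub>0 'b" and i
  assume y: "(\<forall>i<r. y i \<in> {f. Poly_Mapping.keys f \<subseteq> T i}) \<and> (\<Sum>i<r. y i) = 0" and i: "i < r"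
  show "y i = 0"
  proof (rule poly_mapping_eqI)
    fix t
    show "Poly_Mapping.lookup (y i) t = Poly_Mapping.lookup 0 t"
    proof (cases "t \<in> T i")
      case True
      have "Poly_Mapping.lookup (y j) t = 0" if "j < r" "j \<noteq> i" for j
      proof -
        have "t \<notin> T j"
          using True that disj i by (auto simp: disjoint_family_on_def)
        then show ?thesis
          using y that by (auto simp: in_keys_iff subset_iff)
      qed
      then have "(\<Sum>j<r. Poly_Mapping.lookup (y j) t) = (\<Sum>j\<in>{i}. Poly_Mapping.lookup (y j) t)"
        using i by (intro sum.mono_neutral_right) auto
      then show ?thesis
        using y by (simp flip: lookup_sum)
    next
      case False
      then show ?thesis
        using y i by (auto simp: in_keys_iff subset_iff)
    qed
  qed
qed

lemma internal_direct_sum_cong: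
  assumes "\<And>i. i < r \<Longrightarrow> V i = W i"
  shows "internal_direct_sum M r V \<longleftrightarrow> internal_direct_sum M r W"
proof -
  have "(\<forall>i<r. y i \<in> V i) \<longleftrightarrow> (\<forall>i<r. y i \<in> W i)" for y
    using assms by auto
  then show ?thesis
    by (simp add: internal_direct_sum_def)
qed

text \<open>List the cones in any order and generate each summand by the monomial with coefficient 1
  at the apex.\<close>

lemma stanley_decomposition_of_cone_partition:
  fixes E :: "('x \<Rightarrow>\<^sub>0 nat) set"
  defines "M \<equiv> {f :: ('x, 'k::field) mpoly. Poly_Mapping.keys f \<subseteq> E}"
  assumes "cone_partition E P"
  obtains D where "stanley_decomposition (*) (\<lambda>d. M \<inter> fine_component d) M D" "length D = card P"
proof -
  from assms(2) have P: "finite P" "disjoint_family_on cone P" "\<Union> (cone ` P) = E"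
    by (auto simp: cone_partition_def)
  obtain xs where xs: "set xs = P" "distinct xs"
    using finite_distinct_list[OF P(1)] by auto
  define D :: "(('x, 'k) mpoly \<times> 'x set) list"
    where "D = map (\<lambda>(s, Z). (Poly_Mapping.single s 1, Z)) xs"
  have space: "stanley_space (*) (fst (D ! i)) (snd (D ! i)) = {f. Poly_Mapping.keys f \<subseteq> cone (xs ! i)}"
    if "i < length D" for i
    using that by (cases "xs ! i") (simp add: D_def stanley_space_monomial)
  have disj: "disjoint_family_on (\<lambda>i. cone (xs ! i)) {..<length D}"
    using P(2) xs by (auto simp: disjoint_family_on_def D_def disjoint_iff nth_eq_iff_index_eq
      dest: nth_mem) (metis nth_eq_iff_index_eq nth_mem)
  have union: "\<Union> ((\<lambda>i. cone (xs ! i)) ` {..<length D}) = E"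
    using P(3) xs(1) by (auto simp: D_def set_conv_nth)
  have "internal_direct_sum M (length D)
      (\<lambda>i. stanley_space (*) (fst (D ! i)) (snd (D ! i)))"
    unfolding M_def
    by (subst internal_direct_sum_cong[OF space])
      (auto intro: internal_direct_sum_restrict[OF disj union])
  moreover have "u \<in> M \<and> (\<exists>d. u \<in> M \<inter> fine_component d) \<and>
      free_module_over (polys_in Z) (*) (stanley_space (*) u Z)" if uZ: "(u, Z) \<in> set D" for u Z
  proof -
    obtain s where s: "u = Poly_Mapping.single s 1" "(s, Z) \<in> P"
      using uZ xs(1) by (auto simp: D_def)
    have "u \<in> M"
      using s P(3) apex_in_cone[of s Z] by (auto simp: M_def)
    moreover have "u \<in> fine_component (\<lambda>x. int (Poly_Mapping.lookup s x))"
      by (simp add: fine_component_def s)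
    ultimately show ?thesis
      using s free_stanley_space_monomial[of 1 Z s] by auto
  qed
  ultimately have "stanley_decomposition (*) (\<lambda>d. M \<inter> fine_component d) M D"
    by (auto simp: stanley_decomposition_def)
  moreover have "length D = card P"
    using xs distinct_card by (fastforce simp: D_def)
  ultimately show ?thesis
    by (rule that)
qed

section \<open>From Stanley decompositions to cone partitions\<close>

lemma fine_component_eq_single:
  assumes "u \<in> fine_component d" "u \<noteq> 0"
  obtains s c where "c \<noteq> 0" "u = Poly_Mapping.single s c"
proof -
  have "\<exists>s. Poly_Mapping.lookup u s \<noteq> 0"
    using assms(2) by (auto simp: poly_mapping_eq_iff fun_eq_iff)
  then obtain s where s: "s \<in> Poly_Mapping.keys u"
    by (auto simp: in_keys_iff)
  \<comment> \<open>The degree \<open>d\<close> prescribes every coordinate of an exponent, so a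
    homogeneous element has at most one term.\<close>
  have "t = s" if t: "t \<in> Poly_Mapping.keys u" for t
  proof (rule poly_mapping_eqI)
    fix x
    have "int (Poly_Mapping.lookup t x) = d x" "int (Poly_Mapping.lookup s x) = d x"
      using assms(1) s t by (simp_all add: fine_component_def)
    then show "Poly_Mapping.lookup t x = Poly_Mapping.lookup s x"
      by simp
  qed
  then have "u = Poly_Mapping.single s (Poly_Mapping.lookup u s)"
    by (intro poly_mapping_eqI) (auto simp: lookup_single when_def in_keys_iff)
  then show ?thesis
    using s that[of "Poly_Mapping.lookup u s" s] by (simp add: in_keys_iff)
qed

lemma stanley_space_zero: "stanley_space (*) 0 Z = {0 :: ('x, 'k::field) mpoly}"
proof -
  have "(0 :: ('x, 'k) mpoly) \<in> polys_in Z"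
    by (simp add: polys_in_def)
  then show ?thesis
    by (auto simp: stanley_space_def)
qed

lemma internal_direct_sum_summand_subset:
  assumes "internal_direct_sum M r V" "i < r" "\<And>j. j < r \<Longrightarrow> 0 \<in> V j"
  shows "V i \<subseteq> M"
proof
  fix v assume v: "v \<in> V i"
  have "(\<Sum>j<r. if j = i then v else 0) = v"
    using assms(2) by simp
  then show "v \<in> M"
    using assms v unfolding internal_direct_sum_def
    by (auto intro!: exI[of _ "\<lambda>j. if j = i then v else 0"])
qed

lemma internal_direct_sum_disjoint:
  assumes "internal_direct_sum M r V" "i < r" "j < r" "i \<noteq> j" "v \<in> V i" "- v \<in> V j"
    "\<And>k. k < r \<Longrightarrow> 0 \<in> V k"
  shows "v = 0"
proof -
  define y where "y k = (if k = i then v else if k = j then - v else 0)" for k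
  \<comment> \<open>Since \<open>i\<close> and \<open>j\<close> differ, \<open>y\<close> splits into
    two one-point functions, whose sums cancel.\<close>
  have "y k = (if k = i then v else 0) + (if k = j then - v else 0)" for k
    using assms(4) by (auto simp: y_def)
  then have "(\<Sum>k<r. y k) = 0"
    using assms(2,3) by (simp add: sum.distrib)
  moreover have "\<forall>k<r. y k \<in> V k"
    using assms by (auto simp: y_def)
  ultimately have "y i = 0"
    using assms(1,2) by (auto simp: internal_direct_sum_def)
  then show ?thesis
    by (simp add: y_def)
qed

text \<open>The nonzero generators are scalar multiples of monomials, and their exponents are the
  apexes. Testing the direct sum on single monomials shows that the cones are disjoint, lie in
  \<open>E\<close> and cover it.\<close>

lemma cone_partition_of_stanley_decomposition:
  fixes E :: "('x \<Rightarrow>\<^sub>0 nat) set"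
  defines "M \<equiv> {f :: ('x, 'k::field) mpoly. Poly_Mapping.keys f \<subseteq> E}"
  assumes D: "stanley_decomposition (*) (\<lambda>d. M \<inter> fine_component d) M D"
  obtains P where "cone_partition E P" "card P \<le> length D"
proof -
  define V where "V i = stanley_space (*) (fst (D ! i)) (snd (D ! i))" for i
  have sum: "internal_direct_sum M (length D) V"
    using D by (simp add: stanley_decomposition_def V_def[abs_def])
  \<comment> \<open>Zero generators are admissible: \<open>{0}\<close> is free with empty basis. They are discarded.\<close>
  define N where "N = {i. i < length D \<and> fst (D ! i) \<noteq> 0}"
  have "\<exists>s c. c \<noteq> 0 \<and> fst (D ! i) = Poly_Mapping.single s c" if "i \<in> N" for i
  proof -
    have "i < length D" "fst (D ! i) \<noteq> 0"
      using that by (auto simp: N_def)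
    moreover obtain d where "fst (D ! i) \<in> fine_component d"
      using D nth_mem[OF \<open>i < length D\<close>]
      by (cases "D ! i") (fastforce simp: stanley_decomposition_def)
    ultimately show ?thesis
      by (meson fine_component_eq_single)
  qed
  then obtain s c where sc: "\<And>i. i \<in> N \<Longrightarrow> c i \<noteq> 0 \<and> fst (D ! i) = Poly_Mapping.single (s i) (c i)"
    by metis
  define w where "w i = (s i, snd (D ! i))" for i
  have V: "V i = (if i \<in> N then {f. Poly_Mapping.keys f \<subseteq> cone (w i)} else {0})"
    if "i < length D" for i
    using that sc[of i] by (auto simp: V_def w_def N_def stanley_space_monomial stanley_space_zero)
  have zero: "0 \<in> V i" if "i < length D" for i
    by (simp add: V[OF that])
  have disj: "cone (w i) \<inter> cone (w j) = {}" if "i \<in> N" "j \<in> N" "i \<noteq> j" for i j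
  proof (rule ccontr)
    assume "cone (w i) \<inter> cone (w j) \<noteq> {}"
    then obtain t where t: "t \<in> cone (w i)" "t \<in> cone (w j)"
      by auto
    \<comment> \<open>A common exponent puts the same monomial into two summands, which contradicts
      directness.\<close>
    define v :: "('x, 'k) mpoly" where "v = Poly_Mapping.single t 1"
    have ij: "i < length D" "j < length D"
      using that by (auto simp: N_def)
    have "v \<in> V i" "- v \<in> V j"
      using t that ij by (auto simp: V v_def simp flip: single_uminus)
    then have "v = 0"
      using internal_direct_sum_disjoint[OF sum ij that(3) _ _ zero] by blast
    then have "Poly_Mapping.lookup v t = 0"
      by simp
    then show False
      by (simp add: v_def)
  qed
  have subset: "cone (w i) \<subseteq> E" if "i \<in> N" for i
  proof
    fix t assume t: "t \<in> cone (w i)"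
    have i: "i < length D"
      using that by (simp add: N_def)
    have "Poly_Mapping.single t (1::'k) \<in> V i"
      using t that i by (simp add: V)
    then have "Poly_Mapping.single t (1::'k) \<in> M"
      using internal_direct_sum_summand_subset[OF sum i zero] by auto
    then show "t \<in> E"
      by (simp add: M_def)
  qed
  have cover: "\<exists>i\<in>N. t \<in> cone (w i)" if "t \<in> E" for t
  proof -
    have "Poly_Mapping.single t (1::'k) \<in> M"
      using that by (simp add: M_def)
    then obtain y where y: "\<forall>i<length D. y i \<in> V i" "Poly_Mapping.single t 1 = (\<Sum>i<length D. y i)"
      using sum by (auto simp: internal_direct_sum_def)
    \<comment> \<open>Some component must contain the exponent \<open>t\<close>. It is nonzero, so
      its index survives the removal of zero generators.\<close>
    have "t \<in> Poly_Mapping.keys (\<Sum>i<length D. y i)"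
      by (simp flip: y(2))
    then obtain i where i: "i < length D" "t \<in> Poly_Mapping.keys (y i)"
      by (auto dest!: subsetD[OF keys_sum])
    moreover have "y i \<in> V i"
      using y(1) i(1) by blast
    ultimately have "i \<in> N" "t \<in> cone (w i)"
      unfolding V[OF i(1)] by (auto split: if_splits)
    then show ?thesis
      by blast
  qed
  have N: "finite N" "card N \<le> length D"
    using card_mono[of "{..<length D}" N] by (auto simp: N_def)
  have "cone_partition E (w ` N)"
    unfolding cone_partition_def disjoint_family_on_def
  proof (intro conjI equalityI)
    show "\<forall>p\<in>w ` N. \<forall>q\<in>w ` N. p \<noteq> q \<longrightarrow> cone p \<inter> cone q = {}"
      using disj by blast
  qed (use N(1) subset cover in auto)
  moreover have "card (w ` N) \<le> length D"
    using card_image_le[OF N(1), of w] N(2) by simp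
  ultimately show ?thesis
    by (rule that)
qed

text \<open>Passing from cones to summands preserves the number of pieces and passing back does not
  increase it, so both minima agree.\<close>

lemma slength_eqI:
  fixes I :: "('x, 'k::field) mpoly set"
  assumes I: "I = {f. Poly_Mapping.keys f \<subseteq> E}"
    and upper: "cone_partition E P" "card P \<le> r"
    and lower: "\<And>P. cone_partition E P \<Longrightarrow> r \<le> card P"
  shows "slength I = r"
proof -
  let ?stanley = "\<lambda>r. \<exists>D. stanley_decomposition (*) (\<lambda>d. I \<inter> fine_component d) I D \<and> length D = r"
  \<comment> \<open>\<open>LEAST\<close> requires a decomposition of length exactly
    \<open>r\<close>, so the two bounds on \<open>card P\<close> are combined first.\<close>
  have "card P = r"
    using lower[OF upper(1)] upper(2) by simp
  then have "?stanley r"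
    unfolding I by (blast intro: stanley_decomposition_of_cone_partition[OF upper(1)])
  moreover have "r \<le> r'" if r': "?stanley r'" for r'
  proof -
    obtain D where D: "stanley_decomposition (*) (\<lambda>d. I \<inter> fine_component d) I D" "length D = r'"
      using r' by blast
    obtain P' where "cone_partition E P'" "card P' \<le> length D"
      using cone_partition_of_stanley_decomposition[OF D(1)[unfolded I]] by blast
    then show ?thesis
      using lower D(2) by fastforce
  qed
  ultimately show ?thesis
    unfolding slength_def stanley_length_def by (rule Least_equality)
qed

section \<open>Monomial ideals as sets of exponents\<close>

lemma module_mult: "module ((*) :: 'r::comm_ring_1 \<Rightarrow> 'r \<Rightarrow> 'r)"
  by unfold_locales (simp_all add: algebra_simps)

text \<open>Multiplication moves exponents upwards, so the right side is a submodule. Conversely,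
  every term of such an \<open>f\<close> is a multiple of one of the generating monomials.\<close>

lemma span_monomials:
  fixes T :: "('x \<Rightarrow>\<^sub>0 nat) set"
  shows "module.span (*) ((\<lambda>t. Poly_Mapping.single t (1::'k::field)) ` T) =
    {f. Poly_Mapping.keys f \<subseteq> (\<Union>s\<in>T. cone (s, UNIV))}" (is "?L = ?R")
proof
  interpret module "(*) :: ('x, 'k) mpoly \<Rightarrow> _"
    by (rule module_mult)
  show "?L \<subseteq> ?R"
  proof (rule span_minimal)
    show "subspace ?R"
    proof (rule subspaceI)
      fix f g :: "('x, 'k) mpoly" assume "f \<in> ?R" "g \<in> ?R"
      then show "f + g \<in> ?R"
        using keys_add[of f g] by blast
    next
      fix f g :: "('x, 'k) mpoly" assume g: "g \<in> ?R"
      have "t + t' \<in> (\<Union>s\<in>T. cone (s, UNIV))" if t': "t' \<in> Poly_Mapping.keys g" for t t'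
      proof -
        obtain s where "s \<in> T" "t' \<in> cone (s, UNIV)"
          using g t' by blast
        then have "t + t' \<in> cone (s, UNIV)"
          unfolding mem_cone_iff by (simp add: lookup_add trans_le_add2)
        with \<open>s \<in> T\<close> show ?thesis
          by blast
      qed
      then have "{t + t' | t t'. t \<in> Poly_Mapping.keys f \<and> t' \<in> Poly_Mapping.keys g}
          \<subseteq> (\<Union>s\<in>T. cone (s, UNIV))"
        by blast
      then show "f * g \<in> ?R"
        using order_trans[OF keys_mult] by simp
    qed simp
  next
    have "\<exists>s\<in>T. t \<in> cone (s, UNIV)" if "t \<in> T" for t
      using that apex_in_cone by blast
    then show "(\<lambda>t. Poly_Mapping.single t 1) ` T \<subseteq> ?R"
      by auto
  qed
  show "?R \<subseteq> ?L"
  proof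
    fix f :: "('x, 'k) mpoly" assume f: "f \<in> ?R"
    have "Poly_Mapping.single t (Poly_Mapping.lookup f t) \<in> ?L"
      if t: "t \<in> Poly_Mapping.keys f" for t
    proof -
      obtain s t' where s: "s \<in> T" "t = s + t'"
        using f t by (auto simp: cone.simps)
      have "Poly_Mapping.single t (Poly_Mapping.lookup f t) =
          Poly_Mapping.single t' (Poly_Mapping.lookup f t) * Poly_Mapping.single s 1"
        by (simp add: s(2) mult_single add.commute)
      then show ?thesis
        using s(1) by (simp add: span_scale span_base)
    qed
    then have "(\<Sum>t\<in>Poly_Mapping.keys f. Poly_Mapping.single t (Poly_Mapping.lookup f t)) \<in> ?L"
      by (rule span_sum)
    then show "f \<in> ?L"
      by (simp add: poly_mapping_eq_sum_single)
  qed
qed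

section \<open>Lines parallel to an axis and the cones along them\<close>

text \<open>By the pigeonhole principle some cone contains infinitely many points of the line
  \<open>x = c\<close>, so it extends in direction \<open>y\<close>. For \<open>c < p\<close> it
  cannot also extend in direction \<open>x\<close>, as its apex would lie too far out. Hence its
  apex has \<open>x\<close>-coordinate \<open>c\<close>, and different lines need different
  cones.\<close>

lemma card_unbounded_cones_ge:
  assumes P: "cone_partition E P" and "x \<noteq> y"
    and lines: "\<And>c. l \<le> c \<Longrightarrow>
      \<exists>N. \<forall>n\<ge>N. Poly_Mapping.single x c + Poly_Mapping.single y n \<in> E"
    and planes: "\<And>s Z. (s, Z) \<in> P \<Longrightarrow> x \<in> Z \<Longrightarrow> y \<in> Z \<Longrightarrow> p \<le> Poly_Mapping.lookup s x"
  shows "p - l \<le> card {w \<in> P. x \<notin> snd w \<and> y \<in> snd w}"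
proof -
  let ?A = "{w \<in> P. x \<notin> snd w \<and> y \<in> snd w}"
  let ?pt = "\<lambda>c n. Poly_Mapping.single x c + Poly_Mapping.single y n"
  have P': "finite P" "\<Union> (cone ` P) = E"
    using P by (auto simp: cone_partition_def)
  have "c \<in> (\<lambda>w. Poly_Mapping.lookup (fst w) x) ` ?A" if c: "l \<le> c" "c < p" for c
  proof -
    obtain N where N: "\<And>n. n \<ge> N \<Longrightarrow> ?pt c n \<in> E"
      using lines[OF c(1)] by blast
    have "\<forall>n\<in>{N..}. \<exists>w\<in>P. ?pt c n \<in> cone w"
      using N P'(2) by blast
    from pigeonhole_infinite_rel[OF infinite_Ici P'(1) this]
    obtain w where w: "w \<in> P" and inf: "infinite {n \<in> {N..}. ?pt c n \<in> cone w}"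
      by blast
    obtain s Z where sZ: "w = (s, Z)"
      by (cases w)
    obtain n where n: "?pt c n \<in> cone (s, Z)"
      using not_finite_existsD[OF inf] unfolding sZ by blast
    \<comment> \<open>A second point with another \<open>y\<close>-coordinate rules out that the
      cone is constant in \<open>y\<close>.\<close>
    obtain n' where n': "n < n'" "?pt c n' \<in> cone (s, Z)"
      using inf unfolding finite_nat_set_iff_bounded_le sZ by (auto simp: not_le)
    have "y \<in> Z"
    proof (rule ccontr)
      assume "y \<notin> Z"
      with n n' \<open>x \<noteq> y\<close> have "Poly_Mapping.lookup s y = n" "Poly_Mapping.lookup s y = n'"
        unfolding mem_cone_iff by (force simp: lookup_add lookup_single when_def)+
      with n'(1) show False
        by simp
    qed
    have s_le: "Poly_Mapping.lookup s x \<le> c"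
      using n \<open>x \<noteq> y\<close> unfolding mem_cone_iff by (auto simp: lookup_add lookup_single dest: spec[of _ x])
    have "x \<notin> Z"
      using planes[of s Z] w sZ \<open>y \<in> Z\<close> s_le c(2) by force
    moreover have "Poly_Mapping.lookup s x = c"
      using n \<open>x \<noteq> y\<close> \<open>x \<notin> Z\<close> unfolding mem_cone_iff
      by (auto simp: lookup_add lookup_single dest: spec[of _ x])
    ultimately show ?thesis
      using w sZ \<open>y \<in> Z\<close> by force
  qed
  then have "{l..<p} \<subseteq> (\<lambda>w. Poly_Mapping.lookup (fst w) x) ` ?A"
    by auto
  then have "card {l..<p} \<le> card ?A"
    using P'(1) by (intro surj_card_le) auto
  then show ?thesis
    by simp
qed

text \<open>As \<open>E\<close> is closed upwards, it meets the line in a ray starting at the lowest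
  point of \<open>E\<close> on it.\<close>

lemma line_eq_cone:
  assumes xy: "x \<noteq> y" "{x, y} = UNIV"
    and up: "\<And>t. t \<in> E \<Longrightarrow> cone (t, UNIV) \<subseteq> E"
    and "Poly_Mapping.single x c + Poly_Mapping.single y n \<in> E"
  shows "\<exists>s. cone (s, {y}) = {t \<in> E. Poly_Mapping.lookup t x = c}"
proof -
  have z: "z = x \<or> z = y" for z
    using xy(2) by blast
  define n0 where "n0 = (LEAST n. Poly_Mapping.single x c + Poly_Mapping.single y n \<in> E)"
  define s where "s = Poly_Mapping.single x c + Poly_Mapping.single y n0"
  have s: "s \<in> E" "Poly_Mapping.lookup s x = c" "Poly_Mapping.lookup s y = n0"
    using LeastI[of "\<lambda>n. Poly_Mapping.single x c + Poly_Mapping.single y n \<in> E", OF assms(4)] xy(1)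
    by (auto simp: s_def n0_def lookup_add lookup_single)
  have "t \<in> cone (s, {y}) \<longleftrightarrow> t \<in> E \<and> Poly_Mapping.lookup t x = c" for t
  proof
    assume t: "t \<in> cone (s, {y})"
    then have "t \<in> cone (s, UNIV)" "Poly_Mapping.lookup t x = Poly_Mapping.lookup s x"
      using xy(1) unfolding mem_cone_iff by blast+
    then show "t \<in> E \<and> Poly_Mapping.lookup t x = c"
      using up[OF s(1)] s(2) by blast
  next
    assume t: "t \<in> E \<and> Poly_Mapping.lookup t x = c"
    have "t = Poly_Mapping.single x c + Poly_Mapping.single y (Poly_Mapping.lookup t y)"
    proof (rule poly_mapping_eqI)
      fix z show "Poly_Mapping.lookup t z = Poly_Mapping.lookup
          (Poly_Mapping.single x c + Poly_Mapping.single y (Poly_Mapping.lookup t y)) z"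
        using t xy(1) z[of z] by (auto simp: lookup_add lookup_single)
    qed
    \<comment> \<open>\<open>t\<close> is itself a point of the line, so its height competes in the
      minimum defining \<open>n0\<close>.\<close>
    then have "n0 \<le> Poly_Mapping.lookup t y"
      using t unfolding n0_def by (intro Least_le) simp
    then have "Poly_Mapping.lookup s z \<le> Poly_Mapping.lookup t z \<and>
        (z \<notin> {y} \<longrightarrow> Poly_Mapping.lookup t z = Poly_Mapping.lookup s z)" for z
      using t s z[of z] by auto
    then show "t \<in> cone (s, {y})"
      unfolding mem_cone_iff by blast
  qed
  then show ?thesis
    by blast
qed

section \<open>Staircases in the plane and both bounds for their cone partitions\<close>

definition staircase :: "nat \<Rightarrow> (nat \<Rightarrow> nat) \<Rightarrow> (nat \<Rightarrow> nat) \<Rightarrow> (2 \<Rightarrow>\<^sub>0 nat) set" where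
  "staircase m a b =
     {t. \<exists>i\<in>{1..m}. a i \<le> Poly_Mapping.lookup t 1 \<and> b i \<le> Poly_Mapping.lookup t 2}"

lemma two_cases: "(x :: 2) = 1 \<or> x = 2"
proof (cases x)
  case (of_int z)
  then have "z = 0 \<or> z = 1"
    by auto
  then show ?thesis
    using of_int by auto
qed

lemma eq_UNIV_2: "1 \<in> Z \<Longrightarrow> 2 \<in> Z \<Longrightarrow> Z = (UNIV :: 2 set)"
  by (metis UNIV_eq_I two_cases)

lemma mem_cone_2:
  "t \<in> cone (s :: 2 \<Rightarrow>\<^sub>0 nat, UNIV) \<longleftrightarrow>
     Poly_Mapping.lookup s 1 \<le> Poly_Mapping.lookup t 1 \<and>
     Poly_Mapping.lookup s 2 \<le> Poly_Mapping.lookup t 2"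
proof -
  have "(\<forall>x::2. Q x) \<longleftrightarrow> Q 1 \<and> Q 2" for Q
    using two_cases by metis
  then show ?thesis
    unfolding mem_cone_iff by simp
qed

text \<open>The index \<open>i\<close> belongs to a corner dominated by the apex of the unique
  quadrant. Sums replace differences to avoid truncated subtraction.\<close>

lemma card_cone_partition_staircase_ge:
  assumes P: "cone_partition (staircase m a b) P" and m: "m \<ge> 1"
  shows "\<exists>i\<in>{1..m}. a i + b i + 1 \<le> card P + a m + b 1"
proof -
  define U where "U = {w \<in> P. 1 \<in> snd w \<and> 2 \<in> snd w}"
  define V where "V = {w \<in> P. 1 \<notin> snd w \<and> 2 \<in> snd w}"
  define H where "H = {w \<in> P. 2 \<notin> snd w \<and> 1 \<in> snd w}"
  have P': "finite P" "disjoint_family_on cone P" "\<Union> (cone ` P) = staircase m a b"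
    using P by (auto simp: cone_partition_def)
  \<comment> \<open>The last corner reaches furthest left, so column \<open>c\<close> lies in the
    staircase from height \<open>b m\<close> on. Rows use the first corner in the same way.\<close>
  have columns: "\<exists>N. \<forall>n\<ge>N. Poly_Mapping.single 1 c + Poly_Mapping.single 2 n \<in> staircase m a b"
    if "a m \<le> c" for c
    using that m by (intro exI[of _ "b m"]) (auto simp: staircase_def lookup_add lookup_single intro!: bexI[of _ m])
  have rows: "\<exists>N. \<forall>n\<ge>N. Poly_Mapping.single 2 c + Poly_Mapping.single 1 n \<in> staircase m a b"
    if "b 1 \<le> c" for c
    using that m by (intro exI[of _ "a 1"]) (auto simp: staircase_def lookup_add lookup_single intro!: bexI[of _ 1])
  have "\<exists>s. (s, UNIV) \<in> U"
  proof (rule ccontr)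
    assume "\<nexists>s. (s, UNIV) \<in> U"
    then have "(s, Z) \<notin> P" if "1 \<in> Z" "2 \<in> Z" for s Z
      using that eq_UNIV_2[OF that] by (auto simp: U_def)
    \<comment> \<open>Without quadrants the condition on their apexes is vacuous, so
      \<open>p\<close> is arbitrary; this choice forces more vertical cones than \<open>P\<close>
      has members.\<close>
    then have "(a m + card P + 1) - a m \<le> card V"
      unfolding V_def by (intro card_unbounded_cones_ge[OF P _ columns]) auto
    moreover have "card V \<le> card P"
      unfolding V_def by (rule card_mono[OF P'(1)]) auto
    ultimately show False
      by simp
  qed
  then obtain s where s: "(s, UNIV) \<in> U"
    by blast
  have unique: "s' = s" if Z: "(s', Z) \<in> P" "1 \<in> Z" "2 \<in> Z" for s' Z
  proof -
    have "Z = UNIV"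
      using Z(2,3) by (rule eq_UNIV_2)
    \<comment> \<open>The sum of the two apexes lies in both quadrants.\<close>
    have "s + s' \<in> cone (s, UNIV) \<inter> cone (s', Z)"
      unfolding \<open>Z = UNIV\<close> Int_iff mem_cone_2 by (simp add: lookup_add)
    moreover have "(s, UNIV) \<in> P"
      using s by (simp add: U_def)
    ultimately have "(s, UNIV) = (s', Z)"
      using disjoint_family_onD[OF P'(2) _ Z(1), of "(s, UNIV)"] by (metis empty_iff)
    then show ?thesis
      by simp
  qed
  have "s \<in> staircase m a b"
    unfolding P'(3)[symmetric]
    by (rule UN_I[of "(s, UNIV)"]) (use s apex_in_cone in \<open>auto simp: U_def\<close>)
  then obtain i where i: "i \<in> {1..m}" "a i \<le> Poly_Mapping.lookup s 1" "b i \<le> Poly_Mapping.lookup s 2"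
    by (auto simp: staircase_def)
  \<comment> \<open>Every quadrant has apex \<open>s\<close>, so its coordinates serve as the
    thresholds \<open>p\<close> in the two counts.\<close>
  have "Poly_Mapping.lookup s 1 - a m \<le> card V"
    unfolding V_def by (rule card_unbounded_cones_ge[OF P _ columns]) (use unique in auto)
  moreover have "Poly_Mapping.lookup s 2 - b 1 \<le> card H"
    unfolding H_def by (rule card_unbounded_cones_ge[OF P _ rows]) (use unique in auto)
  \<comment> \<open>The three classes differ in their direction sets, so they are disjoint; the
    quadrant contributes the \<open>+ 1\<close> of the formula.\<close>
  moreover have "card {(s, UNIV)} + card V + card H \<le> card P"
  proof -
    have "card {(s, UNIV)} + card V + card H = card ({(s, UNIV)} \<union> V \<union> H)"
      using P'(1) by (subst card_Un_disjoint; (subst card_Un_disjoint)?) (auto simp: V_def H_def)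
    also have "\<dots> \<le> card P"
      using s by (intro card_mono[OF P'(1)]) (auto simp: U_def V_def H_def)
    finally show ?thesis .
  qed
  ultimately show ?thesis
    using i by (intro bexI[of _ i]) auto
qed

text \<open>An upper estimate of \<open>card P\<close> is enough: for the minimizing
  \<open>i\<close> the lower bound turns it into an equality.\<close>

lemma cone_partition_staircase:
  assumes i: "i \<in> {1..m}"
    and a: "\<And>i j. 1 \<le> i \<Longrightarrow> i < j \<Longrightarrow> j \<le> m \<Longrightarrow> a j < a i"
    and b: "\<And>i j. 1 \<le> i \<Longrightarrow> i < j \<Longrightarrow> j \<le> m \<Longrightarrow> b i < b j"
  obtains P where "cone_partition (staircase m a b) P" "card P + a m + b 1 \<le> a i + b i + 1"
proof -
  let ?E = "staircase m a b"
  have a_m: "a m \<le> a j" if "j \<in> {1..m}" for j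
    using a[of j m] that by (cases "j = m") auto
  have b_1: "b 1 \<le> b j" if "j \<in> {1..m}" for j
    using b[of 1 j] that by (cases "j = 1") auto
  have up: "cone (t, UNIV) \<subseteq> ?E" if "t \<in> ?E" for t
    using that unfolding staircase_def subset_iff mem_cone_2 by (auto intro: order_trans)
  have "\<forall>c\<in>{a m..}. \<exists>s. cone (s, {2}) = {t \<in> ?E. Poly_Mapping.lookup t 1 = c}"
  proof (intro ballI, rule line_eq_cone[OF _ _ up])
    fix c assume "c \<in> {a m..}"
    then show "Poly_Mapping.single 1 c + Poly_Mapping.single 2 (b m) \<in> ?E"
      using i by (auto simp: staircase_def lookup_add lookup_single intro!: bexI[of _ m])
  qed (simp_all add: eq_UNIV_2)
  from bchoice[OF this] obtain f
    where f: "\<And>c. a m \<le> c \<Longrightarrow> cone (f c, {2}) = {t \<in> ?E. Poly_Mapping.lookup t 1 = c}"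
    by auto
  have "\<forall>d\<in>{b 1..}. \<exists>s. cone (s, {1}) = {t \<in> ?E. Poly_Mapping.lookup t 2 = d}"
  proof (intro ballI, rule line_eq_cone[OF _ _ up])
    fix d assume "d \<in> {b 1..}"
    then show "Poly_Mapping.single 2 d + Poly_Mapping.single 1 (a 1) \<in> ?E"
      using i by (auto simp: staircase_def lookup_add lookup_single intro!: bexI[of _ 1])
  qed (simp_all add: eq_UNIV_2)
  from bchoice[OF this] obtain g
    where g: "\<And>d. b 1 \<le> d \<Longrightarrow> cone (g d, {1}) = {t \<in> ?E. Poly_Mapping.lookup t 2 = d}"
    by auto
  define s where "s = Poly_Mapping.single 1 (a i) + Poly_Mapping.single (2::2) (b i)"
  have q: "t \<in> cone (s, UNIV) \<longleftrightarrow> a i \<le> Poly_Mapping.lookup t 1 \<and> b i \<le> Poly_Mapping.lookup t 2" for t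
    unfolding mem_cone_2 by (simp add: s_def lookup_add lookup_single)
  define V where "V = (\<lambda>c. (f c, {2::2})) ` {a m..<a i}"
  define H where "H = (\<lambda>d. (g d, {1::2})) ` {b 1..<b i}"
  define P where "P = insert (s, UNIV) (V \<union> H)"
  \<comment> \<open>A corner \<open>j\<close> below such a point would need \<open>j > i\<close>
    because \<open>a j < a i\<close>, and \<open>j < i\<close> because
    \<open>b j < b i\<close>.\<close>
  have corner: False if "t \<in> ?E" "Poly_Mapping.lookup t 1 < a i" "Poly_Mapping.lookup t 2 < b i" for t
  proof -
    obtain j where j: "j \<in> {1..m}" "a j \<le> Poly_Mapping.lookup t 1" "b j \<le> Poly_Mapping.lookup t 2"
      using \<open>t \<in> ?E\<close> by (auto simp: staircase_def)
    then show False
      using that a[of j i] b[of i j] i by (cases i j rule: linorder_cases) auto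
  qed
  have V: "\<exists>c. a m \<le> c \<and> c < a i \<and> w = (f c, {2}) \<and>
      cone w = {t \<in> ?E. Poly_Mapping.lookup t 1 = c}" if "w \<in> V" for w
    using that f by (auto simp: V_def)
  have H: "\<exists>d. b 1 \<le> d \<and> d < b i \<and> w = (g d, {1}) \<and>
      cone w = {t \<in> ?E. Poly_Mapping.lookup t 2 = d}" if "w \<in> H" for w
    using that g by (auto simp: H_def)
  have VV: "cone w \<inter> cone w' = {}" if "w \<in> V" "w' \<in> V" "w \<noteq> w'" for w w'
    using V[OF that(1)] V[OF that(2)] that(3) by auto
  have HH: "cone w \<inter> cone w' = {}" if "w \<in> H" "w' \<in> H" "w \<noteq> w'" for w w'
    using H[OF that(1)] H[OF that(2)] that(3) by auto
  have VH: "cone w \<inter> cone w' = {}" if "w \<in> V" "w' \<in> H" for w w'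
    using V[OF that(1)] H[OF that(2)] corner by fastforce
  have QV: "cone (s, UNIV) \<inter> cone w = {}" if "w \<in> V" for w
    using V[OF that] q by fastforce
  have QH: "cone (s, UNIV) \<inter> cone w = {}" if "w \<in> H" for w
    using H[OF that] q by fastforce
  have "disjoint_family_on cone P"
    unfolding disjoint_family_on_def P_def
  proof (intro ballI impI)
    fix w w' assume "w \<in> insert (s, UNIV) (V \<union> H)" "w' \<in> insert (s, UNIV) (V \<union> H)" "w \<noteq> w'"
    then show "cone w \<inter> cone w' = {}"
      using VV[of w w'] HH[of w w'] VH[of w w'] VH[of w' w] QV[of w] QV[of w'] QH[of w] QH[of w']
      by auto
  qed
  moreover have "\<Union> (cone ` P) = ?E"
  proof (intro equalityI subsetI)
    fix t assume "t \<in> \<Union> (cone ` P)"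
    then consider "t \<in> cone (s, UNIV)" | w where "w \<in> V" "t \<in> cone w" | w where "w \<in> H" "t \<in> cone w"
      by (auto simp: P_def)
    then show "t \<in> ?E"
    proof cases
      case 1
      then show ?thesis
        using q i by (auto simp: staircase_def)
    next
      case 2
      then show ?thesis
        using V[of w] by auto
    next
      case 3
      then show ?thesis
        using H[of w] by auto
    qed
  next
    fix t assume t: "t \<in> ?E"
    then obtain j
      where j: "j \<in> {1..m}" "a j \<le> Poly_Mapping.lookup t 1" "b j \<le> Poly_Mapping.lookup t 2"
      by (auto simp: staircase_def)
    have "a m \<le> Poly_Mapping.lookup t 1" "b 1 \<le> Poly_Mapping.lookup t 2"
      using a_m[OF j(1)] b_1[OF j(1)] j by simp_all
    \<comment> \<open>A point outside the quadrant falls short of \<open>a i\<close> or of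
      \<open>b i\<close>, so its column or its row is among the chosen cones.\<close>
    then have "t \<in> cone (s, UNIV) \<or>
        Poly_Mapping.lookup t 1 < a i \<and> t \<in> cone (f (Poly_Mapping.lookup t 1), {2}) \<or>
        Poly_Mapping.lookup t 2 < b i \<and> t \<in> cone (g (Poly_Mapping.lookup t 2), {1})"
      using f g q t by auto
    then show "t \<in> \<Union> (cone ` P)"
      using \<open>a m \<le> _\<close> \<open>b 1 \<le> _\<close> unfolding P_def V_def H_def by fastforce
  qed
  moreover have "finite P"
    by (simp add: P_def V_def H_def)
  moreover have "card P + a m + b 1 \<le> a i + b i + 1"
  proof -
    have "card V \<le> a i - a m" "card H \<le> b i - b 1"
      unfolding V_def H_def using card_image_le[OF finite_atLeastLessThan] by fastforce+
    moreover have "card P \<le> Suc (card V + card H)"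
      unfolding P_def using card_insert_le_m1 card_Un_le[of V H]
      by (intro order_trans[OF card_insert_le_m1[of "Suc (card V + card H)"]]) auto
    ultimately show ?thesis
      using a_m[OF i] b_1[OF i] by linarith
  qed
  ultimately show ?thesis
    by (intro that) (auto simp: cone_partition_def)
qed

section \<open>The Stanley length of the ideal\<close>

lemma Var_power: "Var x ^ n = Poly_Mapping.single (Poly_Mapping.single x n) 1"
  by (induction n) (simp_all add: Var_def mult_single flip: single_add)

theorem theorem2p9:
  fixes I :: "(2, 'k::field) mpoly set"
    and a b :: "nat \<Rightarrow> nat"
    and m :: nat
  assumes "monomial_ideal I"
    and "m \<ge> 1"
    and "\<And>i j. 1 \<le> i \<Longrightarrow> i < j \<Longrightarrow> j \<le> m \<Longrightarrow> a i > a j"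
    and "\<And>i j. 1 \<le> i \<Longrightarrow> i < j \<Longrightarrow> j \<le> m \<Longrightarrow> b i < b j"
    and "minimal_monomial_generators I {Var 1 ^ a i * Var 2 ^ b i | i. 1 \<le> i \<and> i \<le> m}"
  shows "int (slength I) =
    Min {int (a i) + int (b i) - int (a m) - int (b 1) | i. 1 \<le> i \<and> i \<le> m} + 1"
proof -
  let ?pt = "\<lambda>i. Poly_Mapping.single 1 (a i) + Poly_Mapping.single (2::2) (b i)"
  let ?d = "\<lambda>i. int (a i) + int (b i) - int (a m) - int (b 1)"
  have I: "I = {f. Poly_Mapping.keys f \<subseteq> staircase m a b}"
  proof -
    have "{Var 1 ^ a i * Var 2 ^ b i | i. 1 \<le> i \<and> i \<le> m} =
        (\<lambda>t. Poly_Mapping.single t (1::'k)) ` ?pt ` {1..m}"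
      by (auto simp: Var_power mult_single)
    then have "I = {f. Poly_Mapping.keys f \<subseteq> (\<Union>s\<in>?pt ` {1..m}. cone (s, UNIV))}"
      using assms(5) by (simp add: minimal_monomial_generators_def span_monomials)
    moreover have "(\<Union>s\<in>?pt ` {1..m}. cone (s, UNIV)) = staircase m a b"
      by (auto simp: staircase_def mem_cone_2 lookup_add lookup_single)
    ultimately show ?thesis
      by simp
  qed
  have Min_set: "{?d i | i. 1 \<le> i \<and> i \<le> m} = ?d ` {1..m}"
    by auto
  have "Min (?d ` {1..m}) \<in> ?d ` {1..m}"
    using assms(2) by (intro Min_in) auto
  \<comment> \<open>The optimal partition puts its quadrant at a corner attaining the
    minimum.\<close>
  then obtain k where k: "k \<in> {1..m}" "Min (?d ` {1..m}) = ?d k"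
    by auto
  obtain P where P: "cone_partition (staircase m a b) P" "card P + a m + b 1 \<le> a k + b k + 1"
    using cone_partition_staircase[of k m a b] k(1) assms(3,4) by blast
  have lower: "?d k + 1 \<le> int (card P')" if P': "cone_partition (staircase m a b) P'" for P'
  proof -
    obtain i where i: "i \<in> {1..m}" "a i + b i + 1 \<le> card P' + a m + b 1"
      using card_cone_partition_staircase_ge[OF P' assms(2)] by blast
    have "?d k \<le> ?d i"
      unfolding k(2)[symmetric] using i(1) by (intro Min_le) auto
    then show ?thesis
      using i(2) by linarith
  qed
  \<comment> \<open>Any other partition has at least \<open>?d k + 1\<close> cones, while
    \<open>P\<close> has at most that many, so \<open>P\<close> is minimal.\<close>
  have "slength I = card P"
  proof (rule slength_eqI[OF I P(1) order_refl])
    fix P' assume "cone_partition (staircase m a b) P'"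
    then show "card P \<le> card P'"
      using lower[of P'] P(2) by linarith
  qed
  then show ?thesis
    unfolding Min_set k(2) using lower[OF P(1)] P(2) by linarith
qed

end
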